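(* Let $U\subseteq\mathbb{R}^3$ be open and let $\phi:U\to\mathbb{C}$ be a biharmonic function. Then $f\circ\phi$ is biharmonic for every holomorphic (complex analytic) function $f:V\to\mathbb{C}$ defined on an open set $V\subseteq\mathbb{C}$ if and only if $\phi$ satisfies $$\sum_{i=1}^3\left(\frac{\partial\phi}{\partial x_i}\right)^2=0$$ and $\phi^2:U\to\mathbb{C}$ is also a biharmonic function.
   Context: $\Delta=\sum_{i=1}^3\partial^2/\partial x_i^2$ is the Euclidean Laplacian. A smooth complex-valued function $u$ on an open subset of $\mathbb{R}^3$ is biharmonic if $\Delta(\Delta u)=0$. The composition $f\circ\phi$ is considered on $\phi^{-1}(V)$, and $\phi^2$ is the square of $\phi$ in $\mathbb{C}$. *)

theory Defs
  imports "HOL-Complex_Analysis.Complex_Analysis"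
begin

definition partial_deriv :: "'n::finite \<Rightarrow> (real ^ 'n \<Rightarrow> complex) \<Rightarrow> real ^ 'n \<Rightarrow> complex" where
  "partial_deriv i u x = vector_derivative (\<lambda>t. u (x + t *\<^sub>R axis i 1)) (at 0)"

lemma partial_deriv_eq_frechet_derivative:
  fixes u :: "real ^ 'n::finite \<Rightarrow> complex"
  assumes "u differentiable (at x)"
  shows "partial_deriv i u x = frechet_derivative u (at x) (axis i 1)"
proof -
  have u: "(u has_derivative frechet_derivative u (at x)) (at x)"
    using assms frechet_derivative_works by blast
  have line: "((\<lambda>t::real. x + t *\<^sub>R axis i 1) has_derivative (\<lambda>t. t *\<^sub>R axis i 1)) (at 0)"
    by (auto intro!: derivative_eq_intros)
  have "((\<lambda>t. u (x + t *\<^sub>R axis i 1)) has_derivative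
      (\<lambda>t. frechet_derivative u (at x) (t *\<^sub>R axis i 1))) (at 0)"
    using has_derivative_compose[OF line] u by simp
  then have "((\<lambda>t. u (x + t *\<^sub>R axis i 1)) has_vector_derivative
      frechet_derivative u (at x) (axis i 1)) (at 0)"
    unfolding has_vector_derivative_def
    using linear_scale[OF has_derivative_linear[OF u]] by simp
  then show ?thesis
    unfolding partial_deriv_def by (rule vector_derivative_at)
qed

text \<open>
  Derivatives are taken in the full space (filter \<open>at x\<close>) and functions are total, so the
  predicates with a set argument below are meant for open sets: there only the values on the
  set matter.
\<close>

primrec C_k_on :: "nat \<Rightarrow> (real ^ 'n::finite \<Rightarrow> complex) \<Rightarrow> (real ^ 'n) set \<Rightarrow> bool" where
  "C_k_on 0 u S \<longleftrightarrow> continuous_on S u"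
| "C_k_on (Suc k) u S \<longleftrightarrow>
     (\<forall>x\<in>S. u differentiable (at x)) \<and> (\<forall>i. C_k_on k (partial_deriv i u) S)"

definition smooth_on :: "(real ^ 'n::finite \<Rightarrow> complex) \<Rightarrow> (real ^ 'n) set \<Rightarrow> bool" where
  "smooth_on u S \<longleftrightarrow> (\<forall>k. C_k_on k u S)"

definition laplacian :: "(real ^ 'n::finite \<Rightarrow> complex) \<Rightarrow> real ^ 'n \<Rightarrow> complex" where
  "laplacian u x = (\<Sum>i\<in>UNIV. partial_deriv i (partial_deriv i u) x)"

definition biharmonic_on :: "(real ^ 'n::finite \<Rightarrow> complex) \<Rightarrow> (real ^ 'n) set \<Rightarrow> bool" where
  "biharmonic_on u S \<longleftrightarrow> smooth_on u S \<and> (\<forall>x\<in>S. laplacian (laplacian u) x = 0)"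

end

theory Submission
  imports Defs
begin

text \<open>
  Write \<open>\<langle>u,v\<rangle> = \<Sum>\<^sub>i \<partial>\<^sub>iu \<partial>\<^sub>iv\<close> for the complex bilinear (not Hermitian) pairing of gradients, and put
  \<open>g = \<langle>\<phi>,\<phi>\<rangle>\<close> and \<open>\<tau> = \<Delta>\<phi>\<close>. A holomorphic \<open>f\<close> has a complex-linear differential, so \<open>f \<circ> \<phi>\<close> obeys the
  one-variable chain rule, \<open>\<partial>\<^sub>i(f \<circ> \<phi>) = f'(\<phi>) \<partial>\<^sub>i\<phi>\<close>, and hence
  \<open>\<Delta>(f \<circ> \<phi>) = f'(\<phi>) \<tau> + f''(\<phi>) g\<close>. Applying \<open>\<Delta>\<close> once more, with the Leibniz rule
  \<open>\<Delta>(uv) = u \<Delta>v + 2\<langle>u,v\<rangle> + v \<Delta>u\<close>, gives (\<open>bilaplacian_holomorphic_comp\<close>)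

  \<open>\<Delta>\<Delta>(f \<circ> \<phi>) = f''''(\<phi>) g\<^sup>2 + 2 f'''(\<phi>) (\<tau> g + \<langle>\<phi>,g\<rangle>) + f''(\<phi>) (\<tau>\<^sup>2 + 2\<langle>\<phi>,\<tau>\<rangle> + \<Delta>g) + f'(\<phi>) \<Delta>\<tau>.\<close>

  The last term vanishes because \<open>\<phi>\<close> is biharmonic. If every \<open>f \<circ> \<phi>\<close> is biharmonic, then the choice
  \<open>f(z) = (z - \<phi>(x))\<^sup>4\<close> isolates the first term at the point \<open>x\<close> and forces \<open>g(x) = 0\<close>. Conversely,
  if \<open>g\<close> vanishes on the open set \<open>U\<close>, then so do \<open>\<langle>\<phi>,g\<rangle>\<close> and \<open>\<Delta>g\<close>, and only
  \<open>f''(\<phi>) (\<tau>\<^sup>2 + 2\<langle>\<phi>,\<tau>\<rangle>)\<close> is left; its second factor does not depend on \<open>f\<close>, and the case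
  \<open>f(z) = z\<^sup>2\<close>, where \<open>f'' = 2\<close>, shows that it is zero exactly when \<open>\<phi>\<^sup>2\<close> is biharmonic.
\<close>

section \<open>Rules for partial derivatives\<close>

lemma has_derivative_imp_partial_deriv:
  fixes u :: "real ^ 'n::finite \<Rightarrow> complex"
  assumes "(u has_derivative D) (at x)"
  shows "partial_deriv i u x = D (axis i 1)"
  using assms partial_deriv_eq_frechet_derivative frechet_derivative_at differentiableI
  by metis

lemma partial_deriv_cong:
  fixes u v :: "real ^ 'n::finite \<Rightarrow> complex"
  assumes "open S" "x \<in> S" "\<And>y. y \<in> S \<Longrightarrow> u y = v y"
  shows "partial_deriv i u x = partial_deriv i v x"
proof -
  have "((\<lambda>t::real. x + t *\<^sub>R axis i 1) \<longlongrightarrow> x + 0 *\<^sub>R axis i 1) (nhds 0)"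
    by (intro tendsto_intros filterlim_ident)
  then have "\<forall>\<^sub>F t in nhds (0::real). x + t *\<^sub>R axis i 1 \<in> S"
    using assms(1,2) topological_tendstoD by fastforce
  then have "\<forall>\<^sub>F t in nhds (0::real). t \<in> UNIV \<longrightarrow> u (x + t *\<^sub>R axis i 1) = v (x + t *\<^sub>R axis i 1)"
    by eventually_elim (use assms(3) in auto)
  then show ?thesis
    unfolding partial_deriv_def by (rule vector_derivative_cong_eq) auto
qed

lemma partial_deriv_const [simp]: "partial_deriv i (\<lambda>x. c) = (\<lambda>x. 0)"
  by (simp add: partial_deriv_def fun_eq_iff)

lemma partial_deriv_add:
  assumes "u differentiable (at x)" "v differentiable (at x)"
  shows "partial_deriv i (\<lambda>x. u x + v x) x = partial_deriv i u x + partial_deriv i v x"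
proof -
  obtain D E where D: "(u has_derivative D) (at x)" and E: "(v has_derivative E) (at x)"
    using assms by (auto simp: differentiable_def)
  show ?thesis
    by (simp add: has_derivative_imp_partial_deriv[OF has_derivative_add[OF D E]]
        has_derivative_imp_partial_deriv[OF D] has_derivative_imp_partial_deriv[OF E])
qed

lemma partial_deriv_mult:
  assumes "u differentiable (at x)" "v differentiable (at x)"
  shows "partial_deriv i (\<lambda>x. u x * v x) x = u x * partial_deriv i v x + partial_deriv i u x * v x"
proof -
  obtain D E where D: "(u has_derivative D) (at x)" and E: "(v has_derivative E) (at x)"
    using assms by (auto simp: differentiable_def)
  show ?thesis
    by (simp add: has_derivative_imp_partial_deriv[OF has_derivative_mult[OF D E]]
        has_derivative_imp_partial_deriv[OF D] has_derivative_imp_partial_deriv[OF E])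
qed

lemma has_derivative_field_comp:
  fixes u :: "real ^ 'n::finite \<Rightarrow> complex"
  assumes D: "(u has_derivative D) (at x)" and f: "f field_differentiable (at (u x))"
  shows "((\<lambda>x. f (u x)) has_derivative (\<lambda>h. deriv f (u x) * D h)) (at x)"
proof -
  have "(f has_derivative (*) (deriv f (u x))) (at (u x))"
    using f field_differentiable_derivI has_field_derivative_imp_has_derivative by blast
  then show ?thesis
    by (rule has_derivative_compose[OF D])
qed

lemma differentiable_field_comp:
  fixes u :: "real ^ 'n::finite \<Rightarrow> complex"
  assumes "u differentiable (at x)" "f field_differentiable (at (u x))"
  shows "(\<lambda>x. f (u x)) differentiable (at x)"
  using assms has_derivative_field_comp by (metis differentiable_def)

lemma partial_deriv_field_comp:
  fixes u :: "real ^ 'n::finite \<Rightarrow> complex"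
  assumes "u differentiable (at x)" "f field_differentiable (at (u x))"
  shows "partial_deriv i (\<lambda>x. f (u x)) x = deriv f (u x) * partial_deriv i u x"
proof -
  obtain D where D: "(u has_derivative D) (at x)"
    using assms by (auto simp: differentiable_def)
  show ?thesis
    by (simp add: has_derivative_imp_partial_deriv[OF has_derivative_field_comp[OF D assms(2)]]
        has_derivative_imp_partial_deriv[OF D])
qed

section \<open>Closure properties of smooth functions\<close>

lemma C_k_on_cong:
  assumes "open S" "\<And>y. y \<in> S \<Longrightarrow> u y = v y"
  shows "C_k_on k u S \<longleftrightarrow> C_k_on k v S"
  using assms(2)
proof (induction k arbitrary: u v)
  case 0
  then show ?case by (simp cong: continuous_on_cong)
next
  case (Suc k)
  have "u differentiable (at x) \<longleftrightarrow> v differentiable (at x)" if "x \<in> S" for x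
    using has_derivative_transform_within_open[OF _ assms(1) that] Suc.prems
    unfolding differentiable_def by metis
  moreover have "C_k_on k (partial_deriv i u) S \<longleftrightarrow> C_k_on k (partial_deriv i v) S" for i
    by (intro Suc.IH partial_deriv_cong[OF assms(1)] Suc.prems)
  ultimately show ?case by simp
qed

text \<open>
  The Leibniz and chain rules multiply a derivative by an undifferentiated factor, so the inductions
  below need the latter at the lower order as well.
\<close>

lemma C_k_on_Suc_imp: "C_k_on (Suc k) u S \<Longrightarrow> C_k_on k u S"
proof (induction k arbitrary: u)
  case 0
  then have "\<And>x. x \<in> S \<Longrightarrow> isCont u x"
    using differentiable_imp_continuous_within by fastforce
  then show ?case by (simp add: continuous_at_imp_continuous_on)
next
  case (Suc k)
  have "C_k_on k (partial_deriv i u) S" for i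
    using Suc.IH[of "partial_deriv i u"] Suc.prems by simp
  then show ?case using Suc.prems by simp
qed

lemma C_k_on_const: "C_k_on k (\<lambda>x. c) S"
  by (induction k arbitrary: c) auto

lemma C_k_on_add:
  assumes "open S" "C_k_on k u S" "C_k_on k v S"
  shows "C_k_on k (\<lambda>x. u x + v x) S"
  using assms(2,3)
proof (induction k arbitrary: u v)
  case 0
  then show ?case by (simp add: continuous_on_add)
next
  case (Suc k)
  have "C_k_on k (partial_deriv i (\<lambda>x. u x + v x)) S" for i
  proof -
    have "C_k_on k (\<lambda>x. partial_deriv i u x + partial_deriv i v x) S" (is ?C)
      using Suc by simp
    moreover have "C_k_on k (partial_deriv i (\<lambda>x. u x + v x)) S \<longleftrightarrow> ?C"
      by (rule C_k_on_cong[OF assms(1)]) (use Suc.prems in \<open>simp add: partial_deriv_add\<close>)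
    ultimately show ?thesis by blast
  qed
  then show ?case using Suc.prems by simp
qed

lemma C_k_on_mult:
  assumes "open S" "C_k_on k u S" "C_k_on k v S"
  shows "C_k_on k (\<lambda>x. u x * v x) S"
  using assms(2,3)
proof (induction k arbitrary: u v)
  case 0
  then show ?case by (simp add: continuous_on_mult)
next
  case (Suc k)
  have "C_k_on k (partial_deriv i (\<lambda>x. u x * v x)) S" for i
  proof -
    have "C_k_on k (\<lambda>x. u x * partial_deriv i v x + partial_deriv i u x * v x) S" (is ?C)
      using Suc C_k_on_Suc_imp[OF Suc.prems(1)] C_k_on_Suc_imp[OF Suc.prems(2)]
      by (intro C_k_on_add assms(1) Suc.IH) simp_all
    moreover have "C_k_on k (partial_deriv i (\<lambda>x. u x * v x)) S \<longleftrightarrow> ?C"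
      by (rule C_k_on_cong[OF assms(1)]) (use Suc.prems in \<open>simp add: partial_deriv_mult\<close>)
    ultimately show ?thesis by blast
  qed
  then show ?case using Suc.prems by simp
qed

text \<open>
  The induction has to range over all holomorphic \<open>f\<close>, because the partial derivatives of \<open>f \<circ> u\<close>
  involve \<open>f' \<circ> u\<close>; it closes because \<open>f'\<close> is again holomorphic on \<open>V\<close>.
\<close>

lemma C_k_on_holomorphic_comp:
  assumes "open S" "open V" "u ` S \<subseteq> V" "f holomorphic_on V" "C_k_on k u S"
  shows "C_k_on k (\<lambda>x. f (u x)) S"
  using assms(4,5)
proof (induction k arbitrary: f)
  case 0
  then show ?case
    using continuous_on_compose2[OF holomorphic_on_imp_continuous_on _ assms(3)] by simp
next
  case (Suc k)
  have f: "f field_differentiable (at (u x))" if "x \<in> S" for x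
    using that assms(2,3) Suc.prems(1) holomorphic_on_imp_differentiable_at by blast
  have u: "u differentiable (at x)" if "x \<in> S" for x
    using that Suc.prems(2) by simp
  have "C_k_on k (partial_deriv i (\<lambda>x. f (u x))) S" for i
  proof -
    have "C_k_on k (\<lambda>x. deriv f (u x)) S"
      by (rule Suc.IH[OF holomorphic_deriv[OF Suc.prems(1) assms(2)] C_k_on_Suc_imp[OF Suc.prems(2)]])
    then have "C_k_on k (\<lambda>x. deriv f (u x) * partial_deriv i u x) S" (is ?C)
      using Suc.prems(2) by (simp add: C_k_on_mult[OF assms(1)])
    moreover have "C_k_on k (partial_deriv i (\<lambda>x. f (u x))) S \<longleftrightarrow> ?C"
      by (rule C_k_on_cong[OF assms(1)]) (simp add: partial_deriv_field_comp u f)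
    ultimately show ?thesis by blast
  qed
  then show ?case using u f by (simp add: differentiable_field_comp)
qed

lemma smooth_on_imp_differentiable: "smooth_on u S \<Longrightarrow> x \<in> S \<Longrightarrow> u differentiable (at x)"
  unfolding smooth_on_def by (drule spec[of _ "Suc 0"]) simp

lemma smooth_on_subset:
  assumes "smooth_on u S" "T \<subseteq> S"
  shows "smooth_on u T"
proof -
  have "C_k_on k u T" if "C_k_on k u S" for k
    using that
  proof (induction k arbitrary: u)
    case 0
    then show ?case using assms(2) continuous_on_subset by auto
  next
    case (Suc k)
    then show ?case using assms(2) by auto
  qed
  then show ?thesis using assms(1) by (simp add: smooth_on_def)
qed

lemma smooth_on_partial_deriv: "smooth_on u S \<Longrightarrow> smooth_on (partial_deriv i u) S"
  unfolding smooth_on_def using C_k_on.simps(2)[of _ u S] by simp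

lemma smooth_on_mult:
  "open S \<Longrightarrow> smooth_on u S \<Longrightarrow> smooth_on v S \<Longrightarrow> smooth_on (\<lambda>x. u x * v x) S"
  by (simp add: smooth_on_def C_k_on_mult)

lemma smooth_on_sum:
  assumes "open S" "\<And>i. i \<in> I \<Longrightarrow> smooth_on (u i) S"
  shows "smooth_on (\<lambda>x. \<Sum>i\<in>I. u i x) S"
  using assms(2)
  by (induction I rule: infinite_finite_induct)
    (auto simp: smooth_on_def C_k_on_const C_k_on_add[OF assms(1)])

lemma smooth_on_holomorphic_comp:
  assumes "open S" "open V" "u ` S \<subseteq> V" "f holomorphic_on V" "smooth_on u S"
  shows "smooth_on (\<lambda>x. f (u x)) S"
  using assms by (simp add: smooth_on_def C_k_on_holomorphic_comp)

lemma smooth_on_laplacian: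
  assumes "open S" "smooth_on u S"
  shows "smooth_on (laplacian u) S"
proof -
  have "laplacian u = (\<lambda>x. \<Sum>i\<in>UNIV. partial_deriv i (partial_deriv i u) x)"
    by (simp add: laplacian_def fun_eq_iff)
  then show ?thesis
    using assms by (simp add: smooth_on_sum smooth_on_partial_deriv)
qed

section \<open>The Laplacian of products and compositions\<close>

definition grad_dot :: "(real ^ 'n::finite \<Rightarrow> complex) \<Rightarrow> (real ^ 'n \<Rightarrow> complex) \<Rightarrow> real ^ 'n \<Rightarrow> complex" where
  "grad_dot u v x = (\<Sum>i\<in>UNIV. partial_deriv i u x * partial_deriv i v x)"

lemma smooth_on_grad_dot:
  assumes "open S" "smooth_on u S" "smooth_on v S"
  shows "smooth_on (grad_dot u v) S"
proof -
  have "grad_dot u v = (\<lambda>x. \<Sum>i\<in>UNIV. partial_deriv i u x * partial_deriv i v x)"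
    by (simp add: grad_dot_def fun_eq_iff)
  then show ?thesis
    using assms by (simp add: smooth_on_sum smooth_on_mult smooth_on_partial_deriv)
qed

lemma grad_dot_cong_right:
  assumes "open S" "x \<in> S" "\<And>y. y \<in> S \<Longrightarrow> v y = w y"
  shows "grad_dot u v x = grad_dot u w x"
  unfolding grad_dot_def using partial_deriv_cong[of S x v w] assms by simp

lemma laplacian_cong:
  assumes "open S" "x \<in> S" "\<And>y. y \<in> S \<Longrightarrow> u y = v y"
  shows "laplacian u x = laplacian v x"
proof -
  have "partial_deriv i (partial_deriv i u) x = partial_deriv i (partial_deriv i v) x" for i
    by (rule partial_deriv_cong[OF assms(1,2)], rule partial_deriv_cong[OF assms(1)])
      (simp_all add: assms(3))
  then show ?thesis by (simp add: laplacian_def)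
qed

lemma laplacian_const [simp]: "laplacian (\<lambda>x. c) x = 0"
  by (simp add: laplacian_def)

lemma laplacian_add:
  assumes S: "open S" "x \<in> S" and u: "smooth_on u S" and v: "smooth_on v S"
  shows "laplacian (\<lambda>x. u x + v x) x = laplacian u x + laplacian v x"
proof -
  have "partial_deriv i (partial_deriv i (\<lambda>x. u x + v x)) x
      = partial_deriv i (partial_deriv i u) x + partial_deriv i (partial_deriv i v) x" for i
  proof -
    have "partial_deriv i (partial_deriv i (\<lambda>x. u x + v x)) x
        = partial_deriv i (\<lambda>x. partial_deriv i u x + partial_deriv i v x) x"
      by (rule partial_deriv_cong[OF S])
        (use u v in \<open>simp add: partial_deriv_add smooth_on_imp_differentiable\<close>)
    also have "\<dots> = partial_deriv i (partial_deriv i u) x + partial_deriv i (partial_deriv i v) x"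
      using S u v
      by (intro partial_deriv_add smooth_on_imp_differentiable[of _ S] smooth_on_partial_deriv)
    finally show ?thesis .
  qed
  then show ?thesis by (simp add: laplacian_def sum.distrib)
qed

lemma laplacian_mult:
  assumes S: "open S" "x \<in> S" and u: "smooth_on u S" and v: "smooth_on v S"
  shows "laplacian (\<lambda>x. u x * v x) x = u x * laplacian v x + 2 * grad_dot u v x + v x * laplacian u x"
proof -
  have "partial_deriv i (partial_deriv i (\<lambda>x. u x * v x)) x
      = u x * partial_deriv i (partial_deriv i v) x + 2 * (partial_deriv i u x * partial_deriv i v x)
        + v x * partial_deriv i (partial_deriv i u) x" for i
  proof -
    note diff = smooth_on_imp_differentiable[OF _ S(2)]
    note u' = smooth_on_partial_deriv[OF u] and v' = smooth_on_partial_deriv[OF v]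
    have "partial_deriv i (partial_deriv i (\<lambda>x. u x * v x)) x
        = partial_deriv i (\<lambda>x. u x * partial_deriv i v x + partial_deriv i u x * v x) x"
      by (rule partial_deriv_cong[OF S])
        (use u v in \<open>simp add: partial_deriv_mult smooth_on_imp_differentiable\<close>)
    also have "\<dots> = partial_deriv i (\<lambda>x. u x * partial_deriv i v x) x
        + partial_deriv i (\<lambda>x. partial_deriv i u x * v x) x"
      by (intro partial_deriv_add diff smooth_on_mult S u v u' v')
    finally show ?thesis
      by (simp add: partial_deriv_mult diff u v u' v' algebra_simps)
  qed
  then show ?thesis by (simp add: laplacian_def grad_dot_def sum.distrib sum_distrib_left)
qed

lemma grad_dot_holomorphic_comp:
  assumes S: "open S" "x \<in> S" and V: "open V" "u ` S \<subseteq> V"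
    and f: "f holomorphic_on V" and u: "smooth_on u S"
  shows "grad_dot (\<lambda>x. f (u x)) v x = deriv f (u x) * grad_dot u v x"
proof -
  have "partial_deriv i (\<lambda>x. f (u x)) x = deriv f (u x) * partial_deriv i u x" for i
    using S V f u holomorphic_on_imp_differentiable_at
    by (intro partial_deriv_field_comp smooth_on_imp_differentiable[OF u]) blast+
  then show ?thesis by (simp add: grad_dot_def sum_distrib_left mult.assoc)
qed

lemma laplacian_holomorphic_comp:
  assumes S: "open S" "x \<in> S" and V: "open V" "u ` S \<subseteq> V"
    and f: "f holomorphic_on V" and u: "smooth_on u S"
  shows "laplacian (\<lambda>x. f (u x)) x
    = deriv f (u x) * laplacian u x + (deriv ^^ 2) f (u x) * grad_dot u u x"
proof -
  have f': "deriv f holomorphic_on V"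
    using f V(1) by (rule holomorphic_deriv)
  have diff: "u differentiable (at y)" "f field_differentiable (at (u y))"
    "deriv f field_differentiable (at (u y))" if "y \<in> S" for y
    using that V u f f' holomorphic_on_imp_differentiable_at smooth_on_imp_differentiable by blast+
  have "partial_deriv i (partial_deriv i (\<lambda>x. f (u x))) x
      = deriv f (u x) * partial_deriv i (partial_deriv i u) x
        + (deriv ^^ 2) f (u x) * (partial_deriv i u x * partial_deriv i u x)" for i
  proof -
    have "partial_deriv i (partial_deriv i (\<lambda>x. f (u x))) x
        = partial_deriv i (\<lambda>x. deriv f (u x) * partial_deriv i u x) x"
      by (rule partial_deriv_cong[OF S]) (simp add: partial_deriv_field_comp diff)
    also have "\<dots> = deriv f (u x) * partial_deriv i (partial_deriv i u) x
        + partial_deriv i (\<lambda>x. deriv f (u x)) x * partial_deriv i u x"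
      by (rule partial_deriv_mult[OF
            differentiable_field_comp[OF diff(1)[OF S(2)] diff(3)[OF S(2)]]
            smooth_on_imp_differentiable[OF smooth_on_partial_deriv[OF u] S(2)]])
    finally show ?thesis
      using S(2) by (simp add: partial_deriv_field_comp diff numeral_2_eq_2)
  qed
  then show ?thesis by (simp add: laplacian_def grad_dot_def sum.distrib sum_distrib_left)
qed

text \<open>
  Both summands of \<open>\<Delta>(f \<circ> u)\<close> are a composition of \<open>u\<close> with a derivative of \<open>f\<close>, times a smooth
  function, so the Leibniz rule reduces the second Laplacian to the two preceding lemmas for \<open>f'\<close>
  and \<open>f''\<close>. The four coefficients depend on \<open>u\<close> alone, which is what allows testing them with
  special \<open>f\<close>.
\<close>

lemma bilaplacian_holomorphic_comp:
  assumes S: "open S" "x \<in> S" and V: "open V" "u ` S \<subseteq> V"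
    and f: "f holomorphic_on V" and u: "smooth_on u S"
  defines "g \<equiv> grad_dot u u" and "\<tau> \<equiv> laplacian u"
  shows "laplacian (laplacian (\<lambda>x. f (u x))) x
    = (deriv ^^ 4) f (u x) * (g x)\<^sup>2
      + 2 * (deriv ^^ 3) f (u x) * (\<tau> x * g x + grad_dot u g x)
      + (deriv ^^ 2) f (u x) * ((\<tau> x)\<^sup>2 + 2 * grad_dot u \<tau> x + laplacian g x)
      + deriv f (u x) * laplacian \<tau> x"
proof -
  have f': "deriv f holomorphic_on V" and f'': "(deriv ^^ 2) f holomorphic_on V"
    using f V(1) by (auto intro!: holomorphic_deriv holomorphic_higher_deriv)
  have g: "smooth_on g S" and \<tau>: "smooth_on \<tau> S"
    unfolding g_def \<tau>_def by (intro smooth_on_grad_dot smooth_on_laplacian S u)+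
  note comp = smooth_on_holomorphic_comp[OF S(1) V _ u]
  have "laplacian (laplacian (\<lambda>x. f (u x))) x
      = laplacian (\<lambda>x. deriv f (u x) * \<tau> x + (deriv ^^ 2) f (u x) * g x) x"
    unfolding g_def \<tau>_def
    by (rule laplacian_cong[OF S], rule laplacian_holomorphic_comp[OF S(1) _ V f u])
  also have "\<dots> = laplacian (\<lambda>x. deriv f (u x) * \<tau> x) x
      + laplacian (\<lambda>x. (deriv ^^ 2) f (u x) * g x) x"
    by (intro laplacian_add[OF S] smooth_on_mult S(1) comp f' f'' g \<tau>)
  also have "laplacian (\<lambda>x. deriv f (u x) * \<tau> x) x
      = deriv f (u x) * laplacian \<tau> x + 2 * ((deriv ^^ 2) f (u x) * grad_dot u \<tau> x)
        + \<tau> x * ((deriv ^^ 2) f (u x) * \<tau> x + (deriv ^^ 3) f (u x) * g x)"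
    by (subst laplacian_mult[OF S comp[OF f'] \<tau>], subst grad_dot_holomorphic_comp[OF S V f' u],
        subst laplacian_holomorphic_comp[OF S V f' u])
      (simp add: g_def \<tau>_def eval_nat_numeral)
  also have "laplacian (\<lambda>x. (deriv ^^ 2) f (u x) * g x) x
      = (deriv ^^ 2) f (u x) * laplacian g x + 2 * ((deriv ^^ 3) f (u x) * grad_dot u g x)
        + g x * ((deriv ^^ 3) f (u x) * \<tau> x + (deriv ^^ 4) f (u x) * g x)"
    by (subst laplacian_mult[OF S comp[OF f''] g], subst grad_dot_holomorphic_comp[OF S V f'' u],
        subst laplacian_holomorphic_comp[OF S V f'' u])
      (simp add: g_def \<tau>_def eval_nat_numeral)
  finally show ?thesis
    by (simp add: algebra_simps power2_eq_square)
qed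

section \<open>Holomorphic images of a biharmonic function\<close>

theorem proposition2p4:
  fixes U :: "(real ^ 3) set" and \<phi> :: "real ^ 3 \<Rightarrow> complex"
  assumes "open U" and "biharmonic_on \<phi> U"
  shows "(\<forall>(V :: complex set) (f :: complex \<Rightarrow> complex).
            open V \<and> f holomorphic_on V \<longrightarrow> biharmonic_on (f \<circ> \<phi>) {x \<in> U. \<phi> x \<in> V})
         \<longleftrightarrow>
         (\<forall>x\<in>U. (\<Sum>i\<in>UNIV. (partial_deriv i \<phi> x)\<^sup>2) = 0) \<and>
         biharmonic_on (\<lambda>x. (\<phi> x)\<^sup>2) U"
    (is "?all \<longleftrightarrow> ?iso \<and> ?sq")
proof -
  have \<phi>: "smooth_on \<phi> U" and \<Delta>\<Delta>\<phi>: "\<And>x. x \<in> U \<Longrightarrow> laplacian (laplacian \<phi>) x = 0"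
    using assms(2) by (auto simp: biharmonic_on_def)
  have grad_dot_self: "(\<Sum>i\<in>UNIV. (partial_deriv i \<phi> x)\<^sup>2) = grad_dot \<phi> \<phi> x" for x
    by (simp add: grad_dot_def power2_eq_square)
  show ?thesis
  proof
    assume all: ?all
    have entire: "biharmonic_on (\<lambda>x. f (\<phi> x)) U" if "f holomorphic_on UNIV" for f
      using all[rule_format, of UNIV f] that by (simp add: o_def)
    have "grad_dot \<phi> \<phi> x = 0" if x: "x \<in> U" for x
    proof -
      (* The fourth derivative of f at \<phi> x is 24; those of order 1, 2, 3 vanish there. *)
      define f where "f = (\<lambda>z. (z - \<phi> x) ^ 4)"
      have hol: "f holomorphic_on UNIV"
        unfolding f_def by (intro holomorphic_intros)
      have "(deriv ^^ 4) f (\<phi> x) = 24" and "(deriv ^^ 3) f (\<phi> x) = 0"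
        and "(deriv ^^ 2) f (\<phi> x) = 0" and "(deriv ^^ 1) f (\<phi> x) = 0"
        unfolding f_def higher_deriv_power
        by (simp_all add: eval_nat_numeral pochhammer_Suc)
      then show ?thesis
        using bilaplacian_holomorphic_comp[OF assms(1) x open_UNIV _ hol \<phi>] entire[OF hol] x
        by (simp add: biharmonic_on_def)
    qed
    moreover have ?sq
      by (rule entire) (intro holomorphic_intros)
    ultimately show "?iso \<and> ?sq" by (simp add: grad_dot_self)
  next
    assume R: "?iso \<and> ?sq"
    then have g0: "grad_dot \<phi> \<phi> y = 0" if "y \<in> U" for y
      using that by (simp add: grad_dot_self)
    have grad_g: "grad_dot \<phi> (grad_dot \<phi> \<phi>) x = 0" and \<Delta>g: "laplacian (grad_dot \<phi> \<phi>) x = 0"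
      if "x \<in> U" for x
      using grad_dot_cong_right[OF assms(1) that g0] laplacian_cong[OF assms(1) that g0]
      by (simp_all add: grad_dot_def[of \<phi> "\<lambda>_. 0"])
    have coeff: "(laplacian \<phi> x)\<^sup>2 + 2 * grad_dot \<phi> (laplacian \<phi>) x = 0" if x: "x \<in> U" for x
    proof -
      have hol: "(\<lambda>z::complex. z\<^sup>2) holomorphic_on UNIV"
        by (intro holomorphic_intros)
      have "(deriv ^^ 2) (\<lambda>z::complex. z\<^sup>2) (\<phi> x) = 2"
        using higher_deriv_power[of 2 0 2 "\<phi> x"] by (simp add: eval_nat_numeral pochhammer_Suc)
      then have "laplacian (laplacian (\<lambda>x. (\<phi> x)\<^sup>2)) x
          = 2 * ((laplacian \<phi> x)\<^sup>2 + 2 * grad_dot \<phi> (laplacian \<phi>) x)"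
        by (subst bilaplacian_holomorphic_comp[OF assms(1) x open_UNIV subset_UNIV hol \<phi>])
          (simp add: g0 grad_g \<Delta>g \<Delta>\<Delta>\<phi> x)
      moreover have "laplacian (laplacian (\<lambda>x. (\<phi> x)\<^sup>2)) x = 0"
        using R x by (simp add: biharmonic_on_def)
      ultimately show ?thesis
        by (metis mult_eq_0_iff zero_neq_numeral)
    qed
    show ?all
    proof (intro allI impI, elim conjE)
      fix V f assume V: "open V" and f: "f holomorphic_on V"
      define S where "S = {x \<in> U. \<phi> x \<in> V}"
      have "continuous_on U \<phi>"
        using \<phi> smooth_on_imp_differentiable differentiable_imp_continuous_within
        by (metis continuous_at_imp_continuous_on)
      then have "open (U \<inter> \<phi> -` V)"
        using assms(1) V continuous_on_open_vimage by (metis Int_commute)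
      then have S: "open S" "S \<subseteq> U" "\<phi> ` S \<subseteq> V"
        by (auto simp: S_def vimage_def Int_def)
      have \<phi>S: "smooth_on \<phi> S"
        using \<phi> S(2) by (rule smooth_on_subset)
      have "laplacian (laplacian (\<lambda>x. f (\<phi> x))) x = 0" if x: "x \<in> S" for x
      proof -
        have "x \<in> U" using x S(2) by blast
        then show ?thesis
          by (simp add: bilaplacian_holomorphic_comp[OF S(1) x V S(3) f \<phi>S] g0 grad_g \<Delta>g \<Delta>\<Delta>\<phi> coeff)
      qed
      moreover have "smooth_on (\<lambda>x. f (\<phi> x)) S"
        using S(1) V S(3) f \<phi>S by (rule smooth_on_holomorphic_comp)
      ultimately show "biharmonic_on (f \<circ> \<phi>) {x \<in> U. \<phi> x \<in> V}"
        by (simp add: biharmonic_on_def o_def S_def)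
    qed
  qed
qed

end
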